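(* Let $f,g,h,p$ satisfy the standing assumption (a)--(d), let $\rho_h\in[0,L_h]$ be such that $h+\frac{\rho_h}{2}\|\cdot\|^2$ is convex, and suppose that $f$ is $\sigma_f$-strongly convex for some $\sigma_f>0$. Put $\nu:=\frac{\sigma_f}{L_f+L_h}$, $\theta_0:=\frac{L_h(L_f^2-\sigma_f^2)}{L_f(L_f+L_h)^2}$, $\theta_1:=\frac{L_h}{L_f+L_h}$, $\theta_2:=\frac{\rho_h}{L_f+L_h}$. Let $\tau\ge2$ be such that $$\delta(\tau):=\big(\tau\nu-\tau\theta_1-2(\tau-1)\theta_2\big)^2-8(\theta_0+\nu)(\tau-2)>0\quad\text{and}\quad \tau\nu-\tau\theta_1-2(\tau-1)\theta_2>0.$$ Then $$r(\mu):=\tau^2(\theta_0+\nu)\mu^2-\tau^2\Big(\nu-\theta_1-\frac{2(\tau-1)}{\tau}\theta_2\Big)\mu+2(\tau-2)$$ has two distinct roots $\mu_*$ and $\mu^*$ with $0\le\mu_*<\mu^*\le1$. If $\{(x^k,y^k,z^k)\}$ is generated by the algorithm with this $\tau$ and with stepsize $\alpha=\frac{\tau\mu}{2(L_f+L_h)}$, where $\mu>0$ satisfies $\mu\in[\mu_*,\mu^*]$, then for all $k\ge1$ $$V_{k-1}-V_k\ \ge\ -\frac{c(\alpha)}{2\tau\alpha}\|x^k-x^{k-1}\|^2+\frac{1-\beta\rho_p}{2\beta}\|y^k-y^{k-1}\|^2$$ with $$c(\alpha)=2L_hL_f\alpha^2+\Big(\tau\mu\sigma_f+\tau L_h+2(\tau-1)\rho_h-\tau\sigma_f-\frac{\tau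 L_h\sigma_f^2\mu}{L_f(L_f+L_h)}\Big)\alpha-(2-\tau).$$ In particular, $\{V_k\}$ is nonincreasing if $\mu\in[\mu_*,\mu^*]$ and $\beta\le\rho_p^{-1}$, and strictly decreasing if at least one of these holds strictly (that is, $\mu\in(\mu_*,\mu^* )$ or $\beta<\rho_p^{-1}$).
   Context: Notation. $\mathbb R^n$ carries the Euclidean inner product and norm. A function is $L$-smooth if it is continuously differentiable with $L$-Lipschitz gradient; $\phi$ is $\rho$-weakly convex ($\rho\ge0$) if $\phi+\frac{\rho}{2}\|\cdot\|^2$ is convex, and $\sigma$-strongly convex ($\sigma>0$) if $\phi-\frac\sigma2\|\cdot\|^2$ is convex. $\partial\phi$ denotes the limiting (Mordukhovich) subdifferential: $\xi\in\partial\phi(x)$ iff there are $x^k\to x$ with $\phi(x^k)\to\phi(x)$ and $\xi^k\to\xi$ with $\liminf_{\bar x\to x^k,\bar x\ne x^k}\frac{\phi(\bar x)-\phi(x^k)-\langle\xi^k,\bar x-x^k\rangle}{\|\bar x-x^k\|}\ge0$ for each $k$. The proximal mapping is $\mathrm{prox}_{\gamma\phi}(x)=\arg\min_w\{\phi(w)+\frac1{2\gamma}\|w-x\|^2\}$ (set-valued). Standing assumption. (a) $f:\mathbb R^n\to\mathbb R$ is $L_f$-smooth and proximable; (b) $g:\mathbb R^n\to(-\infty,\infty]$ is proper, closed (lower semicontinuous) and proximable; (c) $h:\mathbb R^n\to\mathbb R$ is $L_h$-smooth; (d) $p:\mathbb R^n\to\mathbb R$ is continuous on an open set containing $\mathrm{dom}(g)$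 and $-p$ is $\rho_p$-weakly convex, $\rho_p\ge0$. ("Proximable" informally means that the proximal mapping is easily computable.) Conventions: $a/\infty=0$, $a/0=\infty$ for $a\ne0$, $\infty/\infty=1$; so $\rho_p^{-1}=\infty$ if $\rho_p=0$, and $\frac{1-\beta\rho_p}{2\beta}$ means $\frac1{2\beta}-\frac{\rho_p}2$ when $\beta=\infty$. Algorithm. Parameters: $\tau>0$, $\alpha\in(0,\infty)$, $\beta\in(0,\infty]$, $\gamma\in(0,\infty)$ with $\frac1\gamma=\frac1\alpha+\frac1\beta$. Starting from $(y^0,z^0)\in\mathbb R^n\times\mathbb R^n$, for all $k\ge0$: $x^k\in\mathrm{prox}_{\alpha f}(z^k)$; $y^{k+1}\in\mathrm{prox}_{\gamma g}\big(\frac\gamma\alpha(2x^k-z^k-\alpha\nabla h(x^k))+\frac\gamma\beta y^k-\gamma\xi^k\big)$ for some $\xi^k\in\partial p(y^k)$; $z^{k+1}=z^k+\tau(y^{k+1}-x^k)$. Merit function. For $\xi\in\partial p(y)$ put $$\Phi_{\Lambda,\xi}(w;y,z,x)=(f+h)(x)+\langle\nabla f(x)+\nabla h(x),w-x\rangle+\tfrac1{2\alpha}\|w-x\|^2+p(y)+\langle\xi,w-y\rangle+\tfrac1{2\beta}\|w-y\|^2+g(w),$$ with $\Lambda=(\alpha,\beta,\gamma)$, and $V_{\Lambda,\xi}(y,z,x)=\min_{w\in\mathbb R^n}\Phi_{\Lambda,\xi}(w;y,z,x)$. For the generated sequence, $V_k:=V_{\Lambda,\xi^k}(y^k,z^k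,x^k)=\Phi_{\Lambda,\xi^k}(y^{k+1};y^k,z^k,x^k)$.
   Formalization: "Strictly decreasing" fails at fixed points (constant sequences), so it is proved, given β ≤ 1/ρ_p, as V_k < V_{k-1} at each step where x^k ≠ x^{k-1} (if μ lies in the open interval) or y^k ≠ y^{k-1} (if β < 1/ρ_p). *)

theory Defs
  imports "HOL-Analysis.Analysis"
begin

definition grad :: "('a::real_inner \<Rightarrow> real) \<Rightarrow> 'a \<Rightarrow> 'a" where
  "grad \<phi> x = (THE D. GDERIV \<phi> x :> D)"

definition L_smooth :: "real \<Rightarrow> ('a::real_inner \<Rightarrow> real) \<Rightarrow> bool" where
  "L_smooth L \<phi> \<longleftrightarrow>
     (\<forall>x. \<phi> differentiable (at x)) \<and> continuous_on UNIV (grad \<phi>) \<and> L-lipschitz_on UNIV (grad \<phi>)"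

definition weakly_convex :: "real \<Rightarrow> ('a::real_normed_vector \<Rightarrow> real) \<Rightarrow> bool" where
  "weakly_convex \<rho> \<phi> \<longleftrightarrow> 0 \<le> \<rho> \<and> convex_on UNIV (\<lambda>x. \<phi> x + \<rho> / 2 * (norm x)\<^sup>2)"

definition strongly_convex :: "real \<Rightarrow> ('a::real_normed_vector \<Rightarrow> real) \<Rightarrow> bool" where
  "strongly_convex \<sigma> \<phi> \<longleftrightarrow> 0 < \<sigma> \<and> convex_on UNIV (\<lambda>x. \<phi> x - \<sigma> / 2 * (norm x)\<^sup>2)"

definition edom :: "('a \<Rightarrow> ereal) \<Rightarrow> 'a set" where
  "edom \<phi> = {x. \<phi> x < \<infinity>}"

definition proper_fun :: "('a \<Rightarrow> ereal) \<Rightarrow> bool" where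
  "proper_fun \<phi> \<longleftrightarrow> (\<forall>x. \<phi> x \<noteq> -\<infinity>) \<and> edom \<phi> \<noteq> {}"

definition lower_semicont :: "('a::topological_space \<Rightarrow> ereal) \<Rightarrow> bool" where
  "lower_semicont \<phi> \<longleftrightarrow> (\<forall>x. \<phi> x \<le> Liminf (at x) \<phi>)"

definition regular_subdiff :: "('a::real_inner \<Rightarrow> real) \<Rightarrow> 'a \<Rightarrow> 'a set" where
  "regular_subdiff \<phi> x =
     {\<xi>. 0 \<le> Liminf (at x) (\<lambda>u. ereal ((\<phi> u - \<phi> x - \<xi> \<bullet> (u - x)) / norm (u - x)))}"

definition limiting_subdiff :: "('a::real_inner \<Rightarrow> real) \<Rightarrow> 'a \<Rightarrow> 'a set" where
  "limiting_subdiff \<phi> x =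
     {\<xi>. \<exists>X \<Xi>. X \<longlonglongrightarrow> x \<and> (\<lambda>k. \<phi> (X k)) \<longlonglongrightarrow> \<phi> x \<and> \<Xi> \<longlonglongrightarrow> \<xi> \<and>
        (\<forall>k. \<Xi> k \<in> regular_subdiff \<phi> (X k))}"

definition prox :: "real \<Rightarrow> ('a::real_inner \<Rightarrow> ereal) \<Rightarrow> 'a \<Rightarrow> 'a set" where
  "prox \<gamma> \<phi> x =
     {w. is_arg_min (\<lambda>w. \<phi> w + ereal (1 / (2 * \<gamma>) * (norm (w - x))\<^sup>2)) (\<lambda>_. True) w}"

text \<open>The stepsize parameter $\beta$ ranges over $(0,\infty]$ and only enters the formulas
  through its real reciprocal, which is $0$ for $\beta = \infty$. In particular
  $\frac{1-\beta\rho}{2\beta}$ reads \<open>recip \<beta> / 2 - \<rho> / 2\<close>.\<close>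

definition recip :: "ereal \<Rightarrow> real" where
  "recip \<beta> = real_of_ereal (1 / \<beta>)"

definition generated_by_algorithm ::
  "('a::real_inner \<Rightarrow> real) \<Rightarrow> ('a \<Rightarrow> ereal) \<Rightarrow> ('a \<Rightarrow> real) \<Rightarrow> ('a \<Rightarrow> real) \<Rightarrow>
   real \<Rightarrow> real \<Rightarrow> ereal \<Rightarrow> real \<Rightarrow>
   (nat \<Rightarrow> 'a) \<Rightarrow> (nat \<Rightarrow> 'a) \<Rightarrow> (nat \<Rightarrow> 'a) \<Rightarrow> (nat \<Rightarrow> 'a) \<Rightarrow> bool"
where
  "generated_by_algorithm f g h p \<tau> \<alpha> \<beta> \<gamma> x y z \<xi> \<longleftrightarrow>
     0 < \<tau> \<and> 0 < \<alpha> \<and> 0 < \<beta> \<and> 0 < \<gamma> \<and> 1 / \<gamma> = 1 / \<alpha> + recip \<beta> \<and>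
     (\<forall>k. x k \<in> prox \<alpha> (\<lambda>w. ereal (f w)) (z k) \<and>
          \<xi> k \<in> limiting_subdiff p (y k) \<and>
          y (Suc k) \<in> prox \<gamma> g
            ((\<gamma> / \<alpha>) *\<^sub>R (2 *\<^sub>R x k - z k - \<alpha> *\<^sub>R grad h (x k))
              + (\<gamma> * recip \<beta>) *\<^sub>R y k - \<gamma> *\<^sub>R \<xi> k) \<and>
          z (Suc k) = z k + \<tau> *\<^sub>R (y (Suc k) - x k))"

text \<open>The arguments $\gamma$ and $z$ of $\Phi_{\Lambda,\xi}(w;y,z,x)$ and
  $V_{\Lambda,\xi}(y,z,x)$ do not occur in the defining formula and are omitted.\<close>

definition merit_Phi ::
  "('a::real_inner \<Rightarrow> real) \<Rightarrow> ('a \<Rightarrow> ereal) \<Rightarrow> ('a \<Rightarrow> real) \<Rightarrow> ('a \<Rightarrow> real) \<Rightarrow>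
   real \<Rightarrow> ereal \<Rightarrow> 'a \<Rightarrow> 'a \<Rightarrow> 'a \<Rightarrow> 'a \<Rightarrow> ereal"
where
  "merit_Phi f g h p \<alpha> \<beta> \<xi> w y x =
     ereal (f x + h x + (grad f x + grad h x) \<bullet> (w - x) + 1 / (2 * \<alpha>) * (norm (w - x))\<^sup>2
       + p y + \<xi> \<bullet> (w - y) + recip \<beta> / 2 * (norm (w - y))\<^sup>2) + g w"

text \<open>The minimum over $w$ is written as an infimum; along a generated sequence it is attained
  and finite, which the theorem states explicitly.\<close>

definition merit_V ::
  "('a::real_inner \<Rightarrow> real) \<Rightarrow> ('a \<Rightarrow> ereal) \<Rightarrow> ('a \<Rightarrow> real) \<Rightarrow> ('a \<Rightarrow> real) \<Rightarrow>
   real \<Rightarrow> ereal \<Rightarrow> 'a \<Rightarrow> 'a \<Rightarrow> 'a \<Rightarrow> ereal"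
where
  "merit_V f g h p \<alpha> \<beta> \<xi> y x = (INF w. merit_Phi f g h p \<alpha> \<beta> \<xi> w y x)"

end

theory Submission
  imports Defs
begin

text \<open>
  Up to a constant, $\Phi_{\Lambda,\xi^k}(\cdot\,;y^k,z^k,x^k)$ is the objective of the proximal
  step for $g$, so $y^{k+1}$ attains $V_k$. Comparing $V_k$ with the value of $\Phi$ at
  $w = y^k$ cancels $g(y^k)$. The $p$-terms are controlled because a limiting subgradient of
  the weakly concave $p$ is a global supergradient up to a quadratic. With $d = x^k - x^{k-1}$,
  $G$ and $H$ the increments of $\nabla f$ and $\nabla h$, and
  $\tau(y^k - x^{k-1}) = d + \alpha G$, the rest equals
  \[ D_f + D_h - \tfrac1\tau\langle H,d\rangle - \tfrac\alpha\tau\|G\|^2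
     - \tfrac\alpha\tau\langle H,G\rangle + \tfrac{2-\tau}{2\tau\alpha}\|d\|^2, \]
  where $D_f$, $D_h$ are the Bregman differences at $(x^{k-1}, x^k)$. The Bregman difference
  $D_f$ is bounded below by the convex combination with weights $\mu$, $1-\mu$ of the
  cocoercivity bound $\|G\|^2/(2L_f)$ and the strong convexity bound $\sigma_f\|d\|^2/2$.
  Finally $c(\alpha) = r(\mu)/2$, which is nonpositive between the roots.
\<close>

section \<open>Subgradients of weakly concave functions\<close>

lemma regular_subgradient_weakly_concave:
  fixes \<phi> :: "'a::real_inner \<Rightarrow> real"
  assumes conv: "convex_on UNIV (\<lambda>x. - \<phi> x + \<rho> / 2 * (norm x)\<^sup>2)"
    and sub: "\<zeta> \<in> regular_subdiff \<phi> x"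
  shows "\<phi> v \<le> \<phi> x + \<zeta> \<bullet> (v - x) + \<rho> / 2 * (norm (v - x))\<^sup>2"
proof (cases "v = x")
  case False
  define N where "N = norm (v - x)"
  have N: "N > 0"
    using False by (simp add: N_def)
  \<comment> \<open>\<open>B\<close> collects the error terms below: once \<open>t \<le> e\<close>,
    they are at most \<open>e * B\<close>.\<close>
  define B where "B = N + \<bar>\<rho>\<bar> / 2 * N\<^sup>2"
  have B: "B > 0"
    using N by (simp add: B_def add_pos_nonneg)
  have bound: "\<phi> v - \<phi> x - \<zeta> \<bullet> (v - x) - \<rho> / 2 * N\<^sup>2 \<le> e * B" if e: "e > 0" for e
  proof -
    have "ereal (- e) < 0"
      using e by (simp add: zero_ereal_def)
    then have "\<forall>\<^sub>F u in at x. ereal (- e) < ereal ((\<phi> u - \<phi> x - \<zeta> \<bullet> (u - x)) / norm (u - x))"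
      using sub unfolding regular_subdiff_def mem_Collect_eq le_Liminf_iff by blast
    then obtain d where d: "d > 0"
      and dd: "\<And>u. u \<noteq> x \<Longrightarrow> dist u x < d \<Longrightarrow> - e < (\<phi> u - \<phi> x - \<zeta> \<bullet> (u - x)) / norm (u - x)"
      unfolding eventually_at by auto
    \<comment> \<open>\<open>t * N < d\<close> places \<open>u\<close> in the neighbourhood where
      the quotient estimate holds; \<open>t \<le> e\<close> makes the quadratic remainder of order
      \<open>e\<close>.\<close>
    define t where "t = min e (d / (2 * N))"
    have t: "t > 0" "t \<le> e" "t * N < d"
      using e d N by (auto simp: t_def min_def field_simps)
    define u where "u = x - t *\<^sub>R (v - x)"
    have ux: "u - x = - (t *\<^sub>R (v - x))" and nu: "norm (u - x) = t * N"
      using t by (simp_all add: u_def N_def)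
    have "- e < (\<phi> u - \<phi> x - \<zeta> \<bullet> (u - x)) / norm (u - x)"
      using t N nu by (intro dd) (auto simp: dist_norm)
    then have 1: "\<phi> u > \<phi> x - t * (\<zeta> \<bullet> (v - x)) - e * (t * N)"
      using t N unfolding nu by (simp add: pos_less_divide_eq ux)
    \<comment> \<open>The weight for which \<open>x\<close> is a convex combination of
      \<open>v\<close> and \<open>u\<close>, because \<open>x - u\<close> is \<open>t\<close> times
      \<open>v - x\<close>.\<close>
    define s where "s = 1 / (1 + t)"
    have s: "s \<ge> 0" "s \<le> 1" "(1 + t) * s = 1" "(1 + t) * (1 - s) = t"
      using t by (auto simp: s_def field_simps)
    have "(1 + t) *\<^sub>R ((1 - s) *\<^sub>R v + s *\<^sub>R u) = t *\<^sub>R v + u"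
      using s(3,4) by (simp only: scaleR_add_right scaleR_scaleR) simp
    also have "\<dots> = (1 + t) *\<^sub>R x"
      by (simp add: u_def algebra_simps)
    finally have x_eq: "(1 - s) *\<^sub>R v + s *\<^sub>R u = x"
      using t by simp
    let ?q = "\<lambda>x. - \<phi> x + \<rho> / 2 * (norm x)\<^sup>2"
    have "?q x \<le> (1 - s) * ?q v + s * ?q u"
      using convex_onD[OF conv s(1,2), of v u] x_eq by simp
    then have "(1 + t) * ?q x \<le> (1 + t) * ((1 - s) * ?q v + s * ?q u)"
      using t by (intro mult_left_mono) auto
    moreover have "(1 + t) * ((1 - s) * a + s * b) = t * a + b" for a b :: real
      using s(3,4) by (simp only: distrib_left mult.assoc[symmetric])
    ultimately have "(1 + t) * ?q x \<le> t * ?q v + ?q u"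
      by metis
    \<comment> \<open>The convexity defect of the squared norm: \<open>v - u\<close> is
      \<open>1 + t\<close> times \<open>v - x\<close>, so after scaling by \<open>1 + t\<close> the
      defect is \<open>t * (1 + t)\<close> times the square of \<open>N\<close>.\<close>
    moreover have "t * (norm v)\<^sup>2 + (norm u)\<^sup>2 - (1 + t) * (norm x)\<^sup>2 = (t + t\<^sup>2) * N\<^sup>2"
      unfolding u_def N_def power2_norm_eq_inner
      by (simp add: inner_commute algebra_simps power2_eq_square)
    ultimately have 2: "t * \<phi> v + \<phi> u \<le> (1 + t) * \<phi> x + \<rho> / 2 * ((t + t\<^sup>2) * N\<^sup>2)"
      by (simp add: distrib_left right_diff_distrib flip: \<open>t * _ + _ - _ = _\<close>) (simp add: algebra_simps)
    have "t * (\<phi> v - \<phi> x - \<zeta> \<bullet> (v - x) - \<rho> / 2 * N\<^sup>2) \<le> t * (e * N + \<rho> / 2 * t * N\<^sup>2)"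
      using 1 2 by (simp add: algebra_simps power2_eq_square)
    then have "\<phi> v - \<phi> x - \<zeta> \<bullet> (v - x) - \<rho> / 2 * N\<^sup>2 \<le> e * N + \<rho> / 2 * t * N\<^sup>2"
      using t by simp
    also have "\<rho> / 2 * t * N\<^sup>2 \<le> \<bar>\<rho>\<bar> / 2 * e * N\<^sup>2"
      using t by (intro mult_right_mono mult_mono) auto
    finally show ?thesis
      by (simp add: B_def algebra_simps)
  qed
  have "\<phi> v - \<phi> x - \<zeta> \<bullet> (v - x) - \<rho> / 2 * N\<^sup>2 \<le> 0"
  proof (rule field_le_epsilon)
    fix e :: real assume "e > 0"
    then show "\<phi> v - \<phi> x - \<zeta> \<bullet> (v - x) - \<rho> / 2 * N\<^sup>2 \<le> 0 + e"
      using bound[of "e / B"] B by simp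
  qed
  then show ?thesis
    by (simp add: N_def)
qed simp

text \<open>Convergence of \<open>\<phi> (X k)\<close> is built into the limiting subdifferential,
  so the inequality for regular subgradients passes to the limit term by term.\<close>

lemma limiting_subgradient_weakly_concave:
  fixes \<phi> :: "'a::real_inner \<Rightarrow> real"
  assumes conv: "convex_on UNIV (\<lambda>x. - \<phi> x + \<rho> / 2 * (norm x)\<^sup>2)"
    and sub: "\<zeta> \<in> limiting_subdiff \<phi> x"
  shows "\<phi> v \<le> \<phi> x + \<zeta> \<bullet> (v - x) + \<rho> / 2 * (norm (v - x))\<^sup>2"
proof -
  obtain X \<Xi> where X: "X \<longlonglongrightarrow> x" "(\<lambda>k. \<phi> (X k)) \<longlonglongrightarrow> \<phi> x" "\<Xi> \<longlonglongrightarrow> \<zeta>"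
    and reg: "\<And>k. \<Xi> k \<in> regular_subdiff \<phi> (X k)"
    using sub by (auto simp: limiting_subdiff_def)
  have "(\<lambda>k. \<phi> (X k) + \<Xi> k \<bullet> (v - X k) + \<rho> / 2 * (norm (v - X k))\<^sup>2)
      \<longlonglongrightarrow> \<phi> x + \<zeta> \<bullet> (v - x) + \<rho> / 2 * (norm (v - x))\<^sup>2"
    by (intro tendsto_intros X)
  then show ?thesis
    by (rule LIMSEQ_le_const) (use regular_subgradient_weakly_concave[OF conv reg] in auto)
qed

section \<open>Gradient inequalities for smooth and convex functions\<close>

text \<open>The first-order remainder quotient tends to 0, so its lower limit is nonnegative.
  Gradient inequalities can thus be read off from the subgradient estimate.\<close>

lemma GDERIV_imp_regular_subdiff:
  fixes \<phi> :: "'a::real_inner \<Rightarrow> real"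
  assumes "GDERIV \<phi> x :> D"
  shows "D \<in> regular_subdiff \<phi> x"
proof -
  have "((\<lambda>u. norm (\<phi> u - \<phi> x - D \<bullet> (u - x)) / norm (u - x)) \<longlongrightarrow> 0) (at x)"
    using assms unfolding gderiv_def has_derivative_iff_norm by (simp add: inner_commute)
  then have "((\<lambda>u. \<bar>(\<phi> u - \<phi> x - D \<bullet> (u - x)) / norm (u - x)\<bar>) \<longlongrightarrow> 0) (at x)"
    by simp
  then have lim: "((\<lambda>u. (\<phi> u - \<phi> x - D \<bullet> (u - x)) / norm (u - x)) \<longlongrightarrow> 0) (at x)"
    by (rule tendsto_rabs_zero_cancel)
  have "0 \<le> Liminf (at x) (\<lambda>u. ereal ((\<phi> u - \<phi> x - D \<bullet> (u - x)) / norm (u - x)))"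
    unfolding le_Liminf_iff
  proof (intro allI impI)
    fix e :: ereal assume "e < 0"
    then show "\<forall>\<^sub>F u in at x. e < ereal ((\<phi> u - \<phi> x - D \<bullet> (u - x)) / norm (u - x))"
      using order_tendstoD(1)[OF lim] 
      by (cases e) (auto simp: zero_ereal_def)
  qed
  then show ?thesis
    by (simp add: regular_subdiff_def)
qed

text \<open>The estimate for weakly concave functions applies to \<open>- \<phi>\<close> with the
  regular subgradient \<open>- D\<close>. Taking \<rho> = 0 gives the tangent inequality for convex
  functions, and \<rho> = -\<sigma> the one for strongly convex functions.\<close>

lemma weakly_convex_gradient_inequality:
  fixes \<phi> :: "'a::real_inner \<Rightarrow> real"
  assumes conv: "convex_on UNIV (\<lambda>x. \<phi> x + \<rho> / 2 * (norm x)\<^sup>2)"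
    and grad: "GDERIV \<phi> x :> D"
  shows "\<phi> v \<ge> \<phi> x + D \<bullet> (v - x) - \<rho> / 2 * (norm (v - x))\<^sup>2"
  using regular_subgradient_weakly_concave[of "\<lambda>x. - \<phi> x" \<rho> "- D" x v] conv
    GDERIV_imp_regular_subdiff[OF GDERIV_minus[OF grad]] by simp

text \<open>The Riesz vector of the derivative \<open>F\<close> is \<open>adjoint F 1\<close>; its
  uniqueness gives the definite description in \<open>grad\<close> its value.\<close>

lemma GDERIV_grad:
  fixes \<phi> :: "'a::euclidean_space \<Rightarrow> real"
  assumes "\<phi> differentiable (at x)"
  shows "GDERIV \<phi> x :> grad \<phi> x"
proof -
  obtain F where F: "(\<phi> has_derivative F) (at x)"
    using assms by (auto simp: differentiable_def)
  have "linear F"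
    using F by (rule has_derivative_linear)
  then have "F = (\<lambda>h. h \<bullet> adjoint F 1)"
    using adjoint_works[of F _ 1] by auto
  then have D: "GDERIV \<phi> x :> adjoint F 1"
    using F by (simp add: gderiv_def)
  moreover have "D' = adjoint F 1" if "GDERIV \<phi> x :> D'" for D'
  proof -
    have "(\<lambda>h. h \<bullet> D') = (\<lambda>h. h \<bullet> adjoint F 1)"
      using that D unfolding gderiv_def by (rule has_derivative_unique)
    then have "\<forall>h. h \<bullet> D' = h \<bullet> adjoint F 1"
      by (rule fun_cong[THEN allI])
    then show ?thesis
      by (rule iffD1[OF vector_eq_ldot])
  qed
  ultimately show ?thesis
    unfolding grad_def by (rule theI)
qed

lemma L_smooth_GDERIV:
  fixes \<phi> :: "'a::euclidean_space \<Rightarrow> real"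
  assumes "L_smooth L \<phi>"
  shows "GDERIV \<phi> x :> grad \<phi> x"
  using assms by (intro GDERIV_grad) (simp add: L_smooth_def)

lemma L_smooth_lipschitz:
  assumes "L_smooth L \<phi>"
  shows "norm (grad \<phi> x - grad \<phi> y) \<le> L * norm (x - y)"
  using assms lipschitz_on_normD[of L UNIV "grad \<phi>" x y] by (simp add: L_smooth_def)

text \<open>Along the segment from \<open>x\<close> to \<open>u\<close>, the gap
  \<open>\<psi>\<close> has nonpositive derivative by Cauchy-Schwarz and the Lipschitz gradient.
  Comparing its endpoints takes the place of an integration.\<close>

lemma descent_lemma:
  fixes \<phi> :: "'a::euclidean_space \<Rightarrow> real"
  assumes smooth: "L_smooth L \<phi>"
  shows "\<phi> u \<le> \<phi> x + grad \<phi> x \<bullet> (u - x) + L / 2 * (norm (u - x))\<^sup>2"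
proof -
  define d where "d = u - x"
  define \<psi> where "\<psi> t = \<phi> (x + t *\<^sub>R d) - t * (grad \<phi> x \<bullet> d) - L / 2 * t\<^sup>2 * (norm d)\<^sup>2" for t
  have "\<psi> 1 \<le> \<psi> 0"
  proof (rule DERIV_nonpos_imp_nonincreasing[of 0 1 \<psi>])
    fix t :: real assume t: "0 \<le> t" "t \<le> 1"
    define D where "D = grad \<phi> (x + t *\<^sub>R d) \<bullet> d - grad \<phi> x \<bullet> d - L * t * (norm d)\<^sup>2"
    have line: "((\<lambda>t. x + t *\<^sub>R d) has_derivative (\<lambda>s. s *\<^sub>R d)) (at t)"
      by (auto intro!: derivative_eq_intros)
    have "((\<lambda>t. \<phi> (x + t *\<^sub>R d)) has_derivative (\<lambda>s. (s *\<^sub>R d) \<bullet> grad \<phi> (x + t *\<^sub>R d))) (at t)"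
      using has_derivative_compose[OF line] L_smooth_GDERIV[OF smooth, of "x + t *\<^sub>R d"]
      unfolding gderiv_def by blast
    then have "((\<lambda>t. \<phi> (x + t *\<^sub>R d)) has_real_derivative grad \<phi> (x + t *\<^sub>R d) \<bullet> d) (at t)"
      unfolding has_field_derivative_def by (simp add: inner_commute mult_commute_abs)
    then have "(\<psi> has_real_derivative D) (at t)"
      unfolding \<psi>_def[abs_def] D_def by (auto intro!: derivative_eq_intros)
    moreover have "grad \<phi> (x + t *\<^sub>R d) \<bullet> d - grad \<phi> x \<bullet> d \<le> (L * norm (t *\<^sub>R d)) * norm d"
      unfolding inner_diff_left[symmetric]
      using L_smooth_lipschitz[OF smooth, of "x + t *\<^sub>R d" x]
      by (intro order.trans[OF norm_cauchy_schwarz] mult_right_mono) auto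
    then have "D \<le> 0"
      using t by (simp add: D_def power2_eq_square mult.assoc)
    ultimately show "\<exists>y. (\<psi> has_real_derivative y) (at t) \<and> y \<le> 0"
      by blast
  qed simp
  then show ?thesis
    by (simp add: \<psi>_def d_def)
qed

text \<open>At an auxiliary point \<open>u\<close> the tangent at \<open>x\<close> bounds
  \<open>\<phi>\<close> from below and the descent lemma at \<open>v\<close> bounds it from
  above.\<close>

lemma smooth_convex_cocoercive:
  fixes \<phi> :: "'a::euclidean_space \<Rightarrow> real"
  assumes smooth: "L_smooth L \<phi>" and L: "0 < L" and conv: "convex_on UNIV \<phi>"
  shows "\<phi> v \<ge> \<phi> x + grad \<phi> x \<bullet> (v - x) + (norm (grad \<phi> v - grad \<phi> x))\<^sup>2 / (2 * L)"
proof -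
  define G where "G = grad \<phi> v - grad \<phi> x"
  \<comment> \<open>\<open>u\<close> minimises the quadratic upper model at \<open>v\<close> of
    \<open>\<phi>\<close> minus the linear function with slope \<open>grad \<phi> x\<close>; the
    decrease of that model is the squared-norm term.\<close>
  define u where "u = v - (1 / L) *\<^sub>R G"
  have "\<phi> x + grad \<phi> x \<bullet> (u - x) \<le> \<phi> u"
    using weakly_convex_gradient_inequality[of \<phi> 0 x _ u] conv L_smooth_GDERIV[OF smooth] by simp
  also have "\<phi> u \<le> \<phi> v + grad \<phi> v \<bullet> (u - v) + L / 2 * (norm (u - v))\<^sup>2"
    by (rule descent_lemma[OF smooth])
  finally have "\<phi> x + grad \<phi> x \<bullet> (v - x) + G \<bullet> (v - u) - L / 2 * (norm (u - v))\<^sup>2 \<le> \<phi> v"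
    by (simp add: G_def inner_diff_left inner_diff_right)
  moreover have "G \<bullet> (v - u) - L / 2 * (norm (u - v))\<^sup>2 = (norm G)\<^sup>2 / (2 * L)"
    using L by (simp add: u_def power2_norm_eq_inner field_simps)
      (simp add: power2_eq_square)
  ultimately show ?thesis
    by (simp add: G_def)
qed

lemma strongly_convex_gradient_inequality:
  fixes \<phi> :: "'a::real_inner \<Rightarrow> real"
  assumes "strongly_convex \<sigma> \<phi>" "GDERIV \<phi> x :> D"
  shows "\<phi> v \<ge> \<phi> x + D \<bullet> (v - x) + \<sigma> / 2 * (norm (v - x))\<^sup>2"
  using weakly_convex_gradient_inequality[of \<phi> "- \<sigma>" x D v] assms by (simp add: strongly_convex_def)

text \<open>Adding the strong convexity inequality to its copy with \<open>x\<close> and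
  \<open>y\<close> exchanged cancels the function values; Cauchy-Schwarz then allows one factor
  \<open>norm (x - y)\<close> to be divided out.\<close>

lemma strongly_convex_gradient_monotone:
  fixes \<phi> :: "'a::euclidean_space \<Rightarrow> real"
  assumes strong: "strongly_convex \<sigma> \<phi>" and smooth: "L_smooth L \<phi>"
  shows "\<sigma> * norm (x - y) \<le> norm (grad \<phi> x - grad \<phi> y)"
proof (cases "x = y")
  case False
  note ineq = strongly_convex_gradient_inequality[OF strong L_smooth_GDERIV[OF smooth]]
  have "\<sigma> * (norm (x - y))\<^sup>2 \<le> (grad \<phi> x - grad \<phi> y) \<bullet> (x - y)"
    using ineq[of x y] ineq[of y x]
    by (simp add: inner_diff_left inner_diff_right norm_minus_commute)
  also have "\<dots> \<le> norm (grad \<phi> x - grad \<phi> y) * norm (x - y)"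
    by (rule norm_cauchy_schwarz)
  finally show ?thesis
    using False by (simp add: power2_eq_square)
qed simp

text \<open>The same gradient increment is bounded below by strong monotonicity and above by the
  Lipschitz bound; a basis vector makes the distance 1.\<close>

lemma strongly_convex_le_smooth:
  fixes \<phi> :: "'a::euclidean_space \<Rightarrow> real"
  assumes strong: "strongly_convex \<sigma> \<phi>" and smooth: "L_smooth L \<phi>"
  shows "\<sigma> \<le> L"
proof -
  obtain b :: 'a where b: "b \<in> Basis"
    using nonempty_Basis by blast
  show ?thesis
    using strongly_convex_gradient_monotone[OF strong smooth, of b 0] L_smooth_lipschitz[OF smooth, of b 0] b
    by simp
qed

lemma strongly_convex_imp_convex:
  fixes \<phi> :: "'a::euclidean_space \<Rightarrow> real"
  assumes "strongly_convex \<sigma> \<phi>"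
  shows "convex_on UNIV \<phi>"
proof -
  have sq: "convex_on UNIV (\<lambda>x::'a. (norm x)\<^sup>2)"
  proof (rule convex_onI)
    fix t :: real and x y :: 'a assume "0 < t" "t < 1"
    then have "0 \<le> t * (1 - t) * (norm (x - y))\<^sup>2"
      by simp
    also have "\<dots> = (1 - t) * (norm x)\<^sup>2 + t * (norm y)\<^sup>2 - (norm ((1 - t) *\<^sub>R x + t *\<^sub>R y))\<^sup>2"
      unfolding power2_norm_eq_inner
      by (simp add: inner_commute algebra_simps power2_eq_square)
    finally show "(norm ((1 - t) *\<^sub>R x + t *\<^sub>R y))\<^sup>2 \<le> (1 - t) * (norm x)\<^sup>2 + t * (norm y)\<^sup>2"
      by simp
  qed simp
  have "convex_on UNIV (\<lambda>x::'a. \<sigma> / 2 * (norm x)\<^sup>2)"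
    using assms by (intro convex_on_cmul sq) (simp add: strongly_convex_def)
  then show ?thesis
    using convex_on_add[of UNIV "\<lambda>x. \<phi> x - \<sigma> / 2 * (norm x)\<^sup>2"] assms
    by (fastforce simp: strongly_convex_def)
qed

section \<open>First-order condition for \<open>f\<close> and descent of the smooth terms\<close>

text \<open>The derivative of the proximal objective vanishes at its minimiser. This eliminates the
  \<open>z\<close> sequence from the later estimates.\<close>

lemma prox_smooth_eq:
  fixes f :: "'a::euclidean_space \<Rightarrow> real"
  assumes smooth: "L_smooth L f" and \<alpha>: "0 < \<alpha>"
    and x: "x \<in> prox \<alpha> (\<lambda>w. ereal (f w)) z"
  shows "z = x + \<alpha> *\<^sub>R grad f x"
proof -
  let ?\<psi> = "\<lambda>w. f w + 1 / (2 * \<alpha>) * (norm (w - z))\<^sup>2"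
  have min: "\<forall>w\<in>UNIV. ?\<psi> x \<le> ?\<psi> w"
    using x by (simp add: prox_def is_arg_min_linorder)
  have "(f has_derivative (\<lambda>v. v \<bullet> grad f x)) (at x)"
    using L_smooth_GDERIV[OF smooth] by (simp add: gderiv_def)
  then have "(?\<psi> has_derivative (\<lambda>v. v \<bullet> grad f x + (1 / \<alpha>) * (v \<bullet> (x - z)))) (at x)"
    unfolding power2_norm_eq_inner using \<alpha>
    by (auto intro!: derivative_eq_intros simp: inner_commute)
  then have "(\<lambda>v. v \<bullet> grad f x + (1 / \<alpha>) * (v \<bullet> (x - z))) = (\<lambda>v. 0)"
    using min by (intro differential_zero_maxmin[of x UNIV]) auto
  then have "\<forall>v. v \<bullet> (grad f x + (1 / \<alpha>) *\<^sub>R (x - z)) = v \<bullet> 0"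
    by (simp add: inner_add_right fun_eq_iff)
  then have "\<alpha> *\<^sub>R (grad f x + (1 / \<alpha>) *\<^sub>R (x - z)) = 0"
    unfolding vector_eq_ldot by simp
  then show ?thesis
    using \<alpha> by (simp add: algebra_simps)
qed

text \<open>Here \<open>x'\<close>, \<open>x\<close>, \<open>y\<close> stand for \<open>x k\<close>,
  \<open>x (Suc k)\<close>, \<open>y (Suc k)\<close>, and both smooth models are evaluated at the
  same point \<open>y\<close>. The difference splits into an \<open>f\<close> part, an
  \<open>h\<close> part and a mixed part, each bounded by a multiple of the squared norm of
  \<open>x - x'\<close>; with the explicit \<open>2 - \<tau>\<close> term these multiples add up to
  the coefficient formed from \<open>c\<close>.\<close>

lemma smooth_merit_descent:
  fixes f h :: "'a::euclidean_space \<Rightarrow> real"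
  assumes f_smooth: "L_smooth L\<^sub>f f" and h_smooth: "L_smooth L\<^sub>h h"
    and h_weak: "convex_on UNIV (\<lambda>x. h x + \<rho>\<^sub>h / 2 * (norm x)\<^sup>2)" and \<rho>\<^sub>h: "\<rho>\<^sub>h \<in> {0..L\<^sub>h}"
    and f_strong: "strongly_convex \<sigma>\<^sub>f f"
    and \<tau>: "1 \<le> \<tau>" and \<mu>: "0 < \<mu>" "\<mu> \<le> 1"
    and \<alpha>_eq: "\<alpha> = \<tau> * \<mu> / (2 * (L\<^sub>f + L\<^sub>h))"
    and step: "\<tau> *\<^sub>R (y - x') = (x - x') + \<alpha> *\<^sub>R (grad f x - grad f x')"
    and c: "c = 2 * L\<^sub>h * L\<^sub>f * \<alpha>\<^sup>2
           + (\<tau> * \<mu> * \<sigma>\<^sub>f + \<tau> * L\<^sub>h + 2 * (\<tau> - 1) * \<rho>\<^sub>h - \<tau> * \<sigma>\<^sub>f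
              - \<tau> * L\<^sub>h * \<sigma>\<^sub>f\<^sup>2 * \<mu> / (L\<^sub>f * (L\<^sub>f + L\<^sub>h))) * \<alpha> - (2 - \<tau>)"
  shows "- c / (2 * \<tau> * \<alpha>) * (norm (x - x'))\<^sup>2 \<le>
    (f x' + h x' + (grad f x' + grad h x') \<bullet> (y - x') + 1 / (2 * \<alpha>) * (norm (y - x'))\<^sup>2)
    - (f x + h x + (grad f x + grad h x) \<bullet> (y - x) + 1 / (2 * \<alpha>) * (norm (y - x))\<^sup>2)"
    (is "_ \<le> ?lhs")
proof -
  define d G H where "d = x - x'" and "G = grad f x - grad f x'" and "H = grad h x - grad h x'"
  \<comment> \<open>\<open>a\<close> is \<open>\<alpha> / \<tau>\<close>, and \<open>K\<close> is
    what remains of the cocoercivity coefficient \<open>\<mu> / (2 * L\<^sub>f)\<close> after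
    \<open>a\<close> is subtracted.\<close>
  define S a N K where "S = L\<^sub>f + L\<^sub>h" and "a = \<mu> / (2 * S)" and "N = (norm d)\<^sup>2"
    and "K = \<mu> * L\<^sub>h / (2 * L\<^sub>f * S)"
  \<comment> \<open>The Bregman differences of \<open>h\<close> in the two orders of
    \<open>x\<close> and \<open>x'\<close>; their sum is \<open>H \<bullet> d\<close>.\<close>
  define A B where "A = h x' - h x + grad h x \<bullet> d" and "B = h x - h x' - grad h x' \<bullet> d"
  define D where "D = f x' - f x + grad f x \<bullet> d"
  have \<sigma>: "0 < \<sigma>\<^sub>f"
    using f_strong by (simp add: strongly_convex_def)
  have L\<^sub>f: "0 < L\<^sub>f"
    using \<sigma> strongly_convex_le_smooth[OF f_strong f_smooth] by simp
  have L\<^sub>h: "0 \<le> L\<^sub>h"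
    using \<rho>\<^sub>h by simp
  have S: "0 < S" and a: "0 < a" and K: "0 \<le> K" and \<alpha>: "\<alpha> = \<tau> * a" "0 < \<alpha>" and N: "0 \<le> N"
    using L\<^sub>f L\<^sub>h \<mu> \<tau> by (auto simp: S_def a_def K_def N_def \<alpha>_eq)
  have aK: "\<mu> / (2 * L\<^sub>f) - a = K"
    using L\<^sub>f S unfolding a_def K_def by (simp add: field_simps) (simp add: S_def algebra_simps)
  have e_inner: "(y - x') \<bullet> v = (d \<bullet> v) / \<tau> + a * (G \<bullet> v)" for v
  proof -
    have "\<tau> * ((y - x') \<bullet> v) = d \<bullet> v + \<alpha> * (G \<bullet> v)"
      using arg_cong[OF step, of "\<lambda>u. u \<bullet> v"] by (simp add: d_def G_def inner_add_left)
    then show ?thesis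
      using \<tau> by (simp add: \<alpha>(1) field_simps)
  qed
  have norm_diff: "(norm (y - x'))\<^sup>2 - (norm (y - x))\<^sup>2 = 2 * ((y - x') \<bullet> d) - N"
    unfolding N_def d_def power2_norm_eq_inner
    by (simp add: inner_commute algebra_simps)
  have "?lhs = D + A - (y - x') \<bullet> G - (y - x') \<bullet> H + 1 / (2 * \<alpha>) * ((norm (y - x'))\<^sup>2 - (norm (y - x))\<^sup>2)"
    unfolding D_def A_def d_def G_def H_def
    by (simp add: inner_commute algebra_simps)
  \<comment> \<open>The term \<open>(d \<bullet> G) / \<tau>\<close> arises from
    \<open>(y - x') \<bullet> G\<close> and, with opposite sign, from the difference of squared
    norms, so it cancels.\<close>
  also have "\<dots> = D + A - (H \<bullet> d) / \<tau> - a * (norm G)\<^sup>2 - a * (H \<bullet> G) + (2 - \<tau>) / (2 * \<tau> * \<alpha>) * N"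
    unfolding norm_diff e_inner power2_norm_eq_inner[of G] N_def power2_norm_eq_inner[of d]
    using \<tau> a unfolding \<alpha>(1) by (simp add: inner_commute field_simps)
  finally have lhs: "?lhs = D + A - (H \<bullet> d) / \<tau> - a * (norm G)\<^sup>2 - a * (H \<bullet> G)
      + (2 - \<tau>) / (2 * \<tau> * \<alpha>) * N" .

  have "D \<ge> (norm G)\<^sup>2 / (2 * L\<^sub>f)"
    using smooth_convex_cocoercive[OF f_smooth L\<^sub>f strongly_convex_imp_convex[OF f_strong], of x x']
    by (simp add: D_def G_def d_def inner_diff_right norm_minus_commute)
  then have D1: "\<mu> * ((norm G)\<^sup>2 / (2 * L\<^sub>f)) \<le> \<mu> * D"
    using \<mu> by (intro mult_left_mono) auto
  have "D \<ge> \<sigma>\<^sub>f / 2 * N"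
    using strongly_convex_gradient_inequality[OF f_strong L_smooth_GDERIV[OF f_smooth], of x x']
    by (simp add: D_def N_def d_def inner_diff_right norm_minus_commute)
  then have D2: "(1 - \<mu>) * (\<sigma>\<^sub>f / 2 * N) \<le> (1 - \<mu>) * D"
    using \<mu> by (intro mult_left_mono) auto
  have D: "D \<ge> (\<mu> / (2 * L\<^sub>f)) * (norm G)\<^sup>2 + (1 - \<mu>) * \<sigma>\<^sub>f / 2 * N"
    using D1 D2 by (simp add: algebra_simps)

  \<comment> \<open>Strong monotonicity converts the surplus \<open>K\<close> times the square of
    \<open>norm G\<close> into a multiple of \<open>N\<close>; this is the source of
    \<open>\<sigma>\<^sub>f\<^sup>2\<close> in \<open>c\<close>.\<close>
  have "\<sigma>\<^sub>f * norm d \<le> norm G"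
    using strongly_convex_gradient_monotone[OF f_strong f_smooth] by (simp add: d_def G_def)
  then have "(\<sigma>\<^sub>f * norm d)\<^sup>2 \<le> (norm G)\<^sup>2"
    using \<sigma> by (intro power_mono) auto
  then have "K * (\<sigma>\<^sub>f\<^sup>2 * N) \<le> K * (norm G)\<^sup>2"
    using K by (intro mult_left_mono) (auto simp: N_def power_mult_distrib)
  then have f_part: "D - a * (norm G)\<^sup>2 \<ge> (1 - \<mu>) * \<sigma>\<^sub>f / 2 * N + K * \<sigma>\<^sub>f\<^sup>2 * N"
    using D by (simp add: aK[symmetric] left_diff_distrib)

  have "A \<ge> - (\<rho>\<^sub>h / 2 * N)"
    using weakly_convex_gradient_inequality[OF h_weak L_smooth_GDERIV[OF h_smooth], of x x']
    by (simp add: A_def N_def d_def inner_diff_right norm_minus_commute)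
  \<comment> \<open>Splitting \<open>H \<bullet> d\<close> as \<open>A + B\<close> will leave
    \<open>A\<close> with the weight \<open>1 - 1 / \<tau>\<close>, nonnegative because
    \<open>\<tau> \<ge> 1\<close>.\<close>
  then have A: "(1 - 1 / \<tau>) * A \<ge> (1 - 1 / \<tau>) * (- (\<rho>\<^sub>h / 2 * N))"
    using \<tau> by (intro mult_left_mono) auto
  \<comment> \<open>A factor 1/2 is given up to match the coefficient
    \<open>2 * (\<tau> - 1) * \<rho>\<^sub>h\<close> in \<open>c\<close>.\<close>
  have "(1 - 1 / \<tau>) * (\<rho>\<^sub>h / 2 * N) \<le> (1 - 1 / \<tau>) * (\<rho>\<^sub>h * N)"
    using \<tau> \<rho>\<^sub>h N by (intro mult_left_mono) (auto simp: mult_right_mono)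
  with A have A': "(1 - 1 / \<tau>) * A \<ge> - ((\<tau> - 1) / \<tau> * \<rho>\<^sub>h * N)"
    using \<tau> by (simp add: field_simps)
  have "B \<le> L\<^sub>h / 2 * N"
    using descent_lemma[OF h_smooth, of x x'] by (simp add: B_def N_def d_def)
  then have "B / \<tau> \<le> L\<^sub>h / 2 * N / \<tau>"
    using \<tau> by (intro divide_right_mono) auto
  \<comment> \<open>Likewise the factor \<open>1 / \<tau>\<close> is given up, which matches the
    term \<open>\<tau> * L\<^sub>h\<close> in \<open>c\<close>.\<close>
  also have "\<dots> \<le> L\<^sub>h / 2 * N"
    using \<tau> mult_left_mono[of 1 \<tau> "L\<^sub>h / 2 * N"] L\<^sub>h N by (simp add: divide_le_eq)
  finally have B: "B / \<tau> \<le> L\<^sub>h / 2 * N" .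
  have "H \<bullet> d = A + B"
    by (simp add: A_def B_def H_def inner_diff_left)
  then have "A - (H \<bullet> d) / \<tau> = (1 - 1 / \<tau>) * A - B / \<tau>"
    by (simp add: algebra_simps add_divide_distrib)
  with A' B have h_part: "A - (H \<bullet> d) / \<tau> \<ge> - ((\<tau> - 1) / \<tau> * \<rho>\<^sub>h * N) - L\<^sub>h / 2 * N"
    by simp

  have "H \<bullet> G \<le> norm H * norm G"
    by (rule norm_cauchy_schwarz)
  also have "\<dots> \<le> (L\<^sub>h * norm d) * (L\<^sub>f * norm d)"
    using L_smooth_lipschitz[OF f_smooth] L_smooth_lipschitz[OF h_smooth] L\<^sub>h
    by (intro mult_mono) (auto simp: d_def G_def H_def)
  also have "\<dots> = L\<^sub>h * L\<^sub>f * N"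
    by (simp add: N_def power2_eq_square)
  finally have mixed: "a * (H \<bullet> G) \<le> a * (L\<^sub>h * L\<^sub>f * N)"
    using a by (intro mult_left_mono) auto

  \<comment> \<open>\<open>c / (2 * \<tau> * \<alpha>)\<close> is \<open>W\<close> plus the term in
    \<open>\<rho>\<^sub>h\<close> minus the term in \<open>2 - \<tau>\<close>; \<open>W\<close>
    holds the remaining coefficients from the three bounds with reversed sign.\<close>
  define W where "W = a * L\<^sub>h * L\<^sub>f - (1 - \<mu>) * \<sigma>\<^sub>f / 2 + L\<^sub>h / 2 - K * \<sigma>\<^sub>f\<^sup>2"
  have "\<tau> * L\<^sub>h * \<sigma>\<^sub>f\<^sup>2 * \<mu> / (L\<^sub>f * S) = 2 * \<tau> * (K * \<sigma>\<^sub>f\<^sup>2)"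
    by (simp add: K_def)
  moreover have "\<alpha>\<^sup>2 = \<tau> * a * \<alpha>"
    by (simp add: \<alpha>(1) power2_eq_square)
  ultimately have "c = 2 * \<tau> * \<alpha> * W + 2 * (\<tau> - 1) * \<rho>\<^sub>h * \<alpha> - (2 - \<tau>)"
    unfolding c S_def[symmetric] W_def by (simp add: algebra_simps) (simp add: field_simps)
  moreover have "2 * \<tau> * \<alpha> * ((\<tau> - 1) / \<tau> * \<rho>\<^sub>h) = 2 * (\<tau> - 1) * \<rho>\<^sub>h * \<alpha>"
    and "2 * \<tau> * \<alpha> * ((2 - \<tau>) / (2 * \<tau> * \<alpha>)) = 2 - \<tau>"
    using \<tau> \<alpha>(2) by simp_all
  ultimately have "c = 2 * \<tau> * \<alpha> * (W + (\<tau> - 1) / \<tau> * \<rho>\<^sub>h - (2 - \<tau>) / (2 * \<tau> * \<alpha>))"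
    by (simp only: distrib_left[of "2 * \<tau> * \<alpha>"] right_diff_distrib[of "2 * \<tau> * \<alpha>"])
  then have "- c / (2 * \<tau> * \<alpha>) = - W - (\<tau> - 1) / \<tau> * \<rho>\<^sub>h + (2 - \<tau>) / (2 * \<tau> * \<alpha>)"
    using \<tau> \<alpha>(2) by simp
  then have "- c / (2 * \<tau> * \<alpha>) * N = (- (a * L\<^sub>h * L\<^sub>f) + (1 - \<mu>) * \<sigma>\<^sub>f / 2 - L\<^sub>h / 2
      - (\<tau> - 1) / \<tau> * \<rho>\<^sub>h + K * \<sigma>\<^sub>f\<^sup>2 + (2 - \<tau>) / (2 * \<tau> * \<alpha>)) * N"
    by (simp add: W_def)
  also have "\<dots> = - (a * (L\<^sub>h * L\<^sub>f * N)) + (1 - \<mu>) * \<sigma>\<^sub>f / 2 * N - L\<^sub>h / 2 * N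
      - (\<tau> - 1) / \<tau> * \<rho>\<^sub>h * N + K * \<sigma>\<^sub>f\<^sup>2 * N + (2 - \<tau>) / (2 * \<tau> * \<alpha>) * N"
    by (simp only: distrib_right left_diff_distrib mult_minus_left mult.assoc)
  also have "\<dots> \<le> ?lhs"
    using f_part h_part mixed unfolding lhs by linarith
  finally show ?thesis
    by (simp add: N_def d_def)
qed

section \<open>The merit function as a proximal objective\<close>

text \<open>Apart from \<open>g\<close>, the merit function is a quadratic in \<open>w\<close> of
  curvature \<open>1 / \<alpha> + recip \<beta> = 1 / \<gamma>\<close>, and completing the square
  centres it at \<open>m\<close>. The relation for \<open>z\<close> makes
  \<open>2 *\<^sub>R x - z\<close> equal to \<open>x - \<alpha> *\<^sub>R grad f x\<close>, which
  supplies the gradient of \<open>f\<close> in the model.\<close>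

lemma merit_Phi_eq_prox_objective:
  fixes f h :: "'a::real_inner \<Rightarrow> real" and x y z \<xi> :: 'a
  assumes \<gamma>: "0 < \<gamma>" "1 / \<gamma> = 1 / \<alpha> + recip \<beta>" and \<alpha>: "0 < \<alpha>"
    and z: "z = x + \<alpha> *\<^sub>R grad f x"
  defines "m \<equiv> (\<gamma> / \<alpha>) *\<^sub>R (2 *\<^sub>R x - z - \<alpha> *\<^sub>R grad h x) + (\<gamma> * recip \<beta>) *\<^sub>R y - \<gamma> *\<^sub>R \<xi>"
  obtains C where "\<And>w. merit_Phi f g h p \<alpha> \<beta> \<xi> w y x
    = (g w + ereal (1 / (2 * \<gamma>) * (norm (w - m))\<^sup>2)) + ereal C"
proof -
  define b where "b = recip \<beta>"
  \<comment> \<open>The negative gradient at 0 of the quadratic \<open>Q\<close> below.\<close>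
  define v where "v = (1 / \<alpha>) *\<^sub>R x - (grad f x + grad h x) + b *\<^sub>R y - \<xi>"
  have m: "m = \<gamma> *\<^sub>R v"
    unfolding m_def v_def z b_def using \<alpha> by (simp add: algebra_simps flip: scaleR_2)
  define Q where "Q w = f x + h x + (grad f x + grad h x) \<bullet> (w - x) + 1 / (2 * \<alpha>) * (norm (w - x))\<^sup>2
       + p y + \<xi> \<bullet> (w - y) + b / 2 * (norm (w - y))\<^sup>2" for w
  have Q: "Q w = Q 0 - v \<bullet> w + 1 / (2 * \<gamma>) * (norm w)\<^sup>2" for w
  proof -
    define i where "i = 1 / \<alpha>"
    have \<gamma>_i: "1 / (2 * \<gamma>) = i / 2 + b / 2" and \<alpha>_i: "1 / (2 * \<alpha>) = i / 2"
      using \<gamma>(2) by (simp_all add: i_def b_def field_simps)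
    have wx: "(norm (w - x))\<^sup>2 = (norm w)\<^sup>2 - 2 * (x \<bullet> w) + (norm x)\<^sup>2"
      and wy: "(norm (w - y))\<^sup>2 = (norm w)\<^sup>2 - 2 * (y \<bullet> w) + (norm y)\<^sup>2"
      by (simp_all add: power2_norm_eq_inner inner_commute algebra_simps)
    have vw: "v \<bullet> w = i * (x \<bullet> w) - (grad f x + grad h x) \<bullet> w + b * (y \<bullet> w) - \<xi> \<bullet> w"
      by (simp add: v_def i_def inner_diff_left inner_add_left)
    show ?thesis
      unfolding Q_def \<gamma>_i \<alpha>_i wx wy vw by (simp add: algebra_simps)
  qed
  have "1 / (2 * \<gamma>) * (norm (w - m))\<^sup>2 = 1 / (2 * \<gamma>) * (norm w)\<^sup>2 - v \<bullet> w + \<gamma> / 2 * (norm v)\<^sup>2" for w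
  proof -
    have "(norm (w - m))\<^sup>2 = (norm w)\<^sup>2 - 2 * \<gamma> * (v \<bullet> w) + \<gamma> * \<gamma> * (norm v)\<^sup>2"
      by (simp add: m power2_norm_eq_inner inner_commute algebra_simps)
    then show ?thesis
      using \<gamma>(1) by (simp add: distrib_left right_diff_distrib)
  qed
  moreover define C where "C = Q 0 - \<gamma> / 2 * (norm v)\<^sup>2"
  ultimately have "Q w = 1 / (2 * \<gamma>) * (norm (w - m))\<^sup>2 + C" for w
    using Q[of w] by simp
  \<comment> \<open>Since \<open>C\<close> is real, the identity also holds where \<open>g w\<close>
    is infinite.\<close>
  then have "merit_Phi f g h p \<alpha> \<beta> \<xi> w y x
      = (g w + ereal (1 / (2 * \<gamma>) * (norm (w - m))\<^sup>2)) + ereal C" for w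
    unfolding merit_Phi_def b_def[symmetric] Q_def[symmetric] by (cases "g w") auto
  then show thesis
    by (rule that)
qed

text \<open>Comparison with a point of the effective domain excludes \<open>\<infinity>\<close>;
  properness excludes \<open>-\<infinity>\<close>.\<close>

lemma prox_finite:
  assumes proper: "proper_fun g" and w: "w \<in> prox \<gamma> g m"
  shows "\<bar>g w\<bar> \<noteq> \<infinity>"
proof -
  obtain w\<^sub>0 where w\<^sub>0: "g w\<^sub>0 < \<infinity>"
    using proper by (auto simp: proper_fun_def edom_def)
  have "g w + ereal (1 / (2 * \<gamma>) * (norm (w - m))\<^sup>2) \<le> g w\<^sub>0 + ereal (1 / (2 * \<gamma>) * (norm (w\<^sub>0 - m))\<^sup>2)"
    using w by (simp add: prox_def is_arg_min_linorder)
  then show ?thesis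
    using w\<^sub>0 proper by (auto simp: proper_fun_def)
qed

section \<open>Quadratic roots and stepsize reciprocals\<close>

text \<open>With \<open>s\<close> the square root of the discriminant, \<open>C \<ge> 0\<close>
  gives \<open>s \<le> B\<close>, so the smaller root is nonnegative. A nonnegative value at 1 and a
  vertex at most 1 give \<open>s \<le> 2 * A - B\<close>, so the larger root is at most 1.\<close>

lemma quadratic_roots_in_unit_interval:
  fixes A B C :: real
  assumes A: "0 < A" and B: "0 < B" and C: "0 \<le> C" and disc: "0 < B\<^sup>2 - 4 * A * C"
    and one: "0 \<le> A - B + C" and vertex: "B \<le> 2 * A"
  shows "\<exists>u v. 0 \<le> u \<and> u < v \<and> v \<le> 1 \<and> (\<forall>x. A * x\<^sup>2 - B * x + C = A * (x - u) * (x - v))"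
proof -
  define s where "s = sqrt (B\<^sup>2 - 4 * A * C)"
  have s: "s > 0" "s\<^sup>2 = B\<^sup>2 - 4 * A * C"
    using disc by (auto simp: s_def)
  have "s\<^sup>2 \<le> B\<^sup>2"
    using A C s by simp
  then have sB: "s \<le> B"
    by (rule power2_le_imp_le) (use B in simp)
  \<comment> \<open>The difference of the two sides is \<open>4 * A * (A - B + C)\<close>.\<close>
  have "s\<^sup>2 \<le> (2 * A - B)\<^sup>2"
    using mult_left_mono[OF one, of "4 * A"] A s(2) by (simp add: power2_eq_square algebra_simps)
  then have sA: "s \<le> 2 * A - B"
    by (rule power2_le_imp_le) (use vertex in simp)
  have "A * x\<^sup>2 - B * x + C = A * (x - (B - s) / (2 * A)) * (x - (B + s) / (2 * A))" for x
  proof -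
    have "4 * A * (A * (x - (B - s) / (2 * A)) * (x - (B + s) / (2 * A)))
        = (2 * A * (x - (B - s) / (2 * A))) * (2 * A * (x - (B + s) / (2 * A)))"
      by simp
    also have "\<dots> = (2 * A * x - (B - s)) * (2 * A * x - (B + s))"
      using A by (simp only: right_diff_distrib[of "2 * A" x]) simp
    also have "\<dots> = 4 * A * (A * x\<^sup>2 - B * x) + (B\<^sup>2 - s\<^sup>2)"
      by (simp add: power2_eq_square algebra_simps)
    also have "\<dots> = 4 * A * (A * x\<^sup>2 - B * x + C)"
      unfolding s(2) by (simp add: algebra_simps)
    finally show ?thesis
      using A by simp
  qed
  then show ?thesis
    using A s sB sA
    by (intro exI[of _ "(B - s) / (2 * A)"] exI[of _ "(B + s) / (2 * A)"])
      (auto simp: divide_strict_right_mono)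
qed

text \<open>For \<rho> = 0 the bound \<open>1 / ereal \<rho>\<close> is \<open>\<infinity>\<close>,
  so every positive \<beta> qualifies, including \<open>\<infinity>\<close> with reciprocal
  0.\<close>

lemma recip_ge:
  assumes "0 < \<beta>" "0 \<le> \<rho>" "\<beta> \<le> 1 / ereal \<rho>"
  shows "\<rho> \<le> recip \<beta>"
  using assms unfolding recip_def
  by (cases \<beta>; cases "\<rho> = 0") (auto simp: one_ereal_def field_simps)

text \<open>For \<rho> = 0 the strict bound says that \<beta> is finite, and then its reciprocal is
  positive.\<close>

lemma recip_gt:
  assumes "0 < \<beta>" "0 \<le> \<rho>" "\<beta> < 1 / ereal \<rho>"
  shows "\<rho> < recip \<beta>"
  using assms unfolding recip_def
  by (cases \<beta>; cases "\<rho> = 0") (auto simp: one_ereal_def field_simps)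

section \<open>Attainment and descent of the merit values\<close>

lemma merit_V_attained:
  fixes f h p :: "'a::euclidean_space \<Rightarrow> real"
  assumes f_smooth: "L_smooth L\<^sub>f f" and g_proper: "proper_fun g"
    and gen: "generated_by_algorithm f g h p \<tau> \<alpha> \<beta> \<gamma> x y z \<xi>"
  shows "merit_V f g h p \<alpha> \<beta> (\<xi> k) (y k) (x k)
      = merit_Phi f g h p \<alpha> \<beta> (\<xi> k) (y (Suc k)) (y k) (x k)"
    and "\<bar>g (y (Suc k))\<bar> \<noteq> \<infinity>"
proof -
  let ?m = "(\<gamma> / \<alpha>) *\<^sub>R (2 *\<^sub>R x k - z k - \<alpha> *\<^sub>R grad h (x k)) + (\<gamma> * recip \<beta>) *\<^sub>R y k - \<gamma> *\<^sub>R \<xi> k"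
  have pos: "0 < \<alpha>" "0 < \<gamma>" "1 / \<gamma> = 1 / \<alpha> + recip \<beta>"
    and x: "x k \<in> prox \<alpha> (\<lambda>w. ereal (f w)) (z k)" and y: "y (Suc k) \<in> prox \<gamma> g ?m"
    using gen by (auto simp: generated_by_algorithm_def)
  show "\<bar>g (y (Suc k))\<bar> \<noteq> \<infinity>"
    by (rule prox_finite[OF g_proper y])
  obtain C where C: "\<And>w. merit_Phi f g h p \<alpha> \<beta> (\<xi> k) w (y k) (x k)
      = (g w + ereal (1 / (2 * \<gamma>) * (norm (w - ?m))\<^sup>2)) + ereal C"
    using merit_Phi_eq_prox_objective[OF pos(2,3,1) prox_smooth_eq[OF f_smooth pos(1) x]] by blast
  have "merit_Phi f g h p \<alpha> \<beta> (\<xi> k) (y (Suc k)) (y k) (x k)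
      \<le> merit_Phi f g h p \<alpha> \<beta> (\<xi> k) w (y k) (x k)" for w
    unfolding C using y by (intro add_right_mono) (simp add: prox_def is_arg_min_linorder)
  then show "merit_V f g h p \<alpha> \<beta> (\<xi> k) (y k) (x k)
      = merit_Phi f g h p \<alpha> \<beta> (\<xi> k) (y (Suc k)) (y k) (x k)"
    unfolding merit_V_def by (intro antisym INF_lower INF_greatest) auto
qed

lemma merit_V_descent:
  fixes f h p :: "'a::euclidean_space \<Rightarrow> real"
  assumes f_smooth: "L_smooth L\<^sub>f f" and g_proper: "proper_fun g" and h_smooth: "L_smooth L\<^sub>h h"
    and p_weak: "weakly_convex \<rho>\<^sub>p (\<lambda>x. - p x)"
    and h_weak: "convex_on UNIV (\<lambda>x. h x + \<rho>\<^sub>h / 2 * (norm x)\<^sup>2)" and \<rho>\<^sub>h: "\<rho>\<^sub>h \<in> {0..L\<^sub>h}"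
    and f_strong: "strongly_convex \<sigma>\<^sub>f f"
    and \<tau>: "1 \<le> \<tau>" and \<mu>: "0 < \<mu>" "\<mu> \<le> 1"
    and \<alpha>_eq: "\<alpha> = \<tau> * \<mu> / (2 * (L\<^sub>f + L\<^sub>h))"
    and gen: "generated_by_algorithm f g h p \<tau> \<alpha> \<beta> \<gamma> x y z \<xi>"
    and c: "c = 2 * L\<^sub>h * L\<^sub>f * \<alpha>\<^sup>2
           + (\<tau> * \<mu> * \<sigma>\<^sub>f + \<tau> * L\<^sub>h + 2 * (\<tau> - 1) * \<rho>\<^sub>h - \<tau> * \<sigma>\<^sub>f
              - \<tau> * L\<^sub>h * \<sigma>\<^sub>f\<^sup>2 * \<mu> / (L\<^sub>f * (L\<^sub>f + L\<^sub>h))) * \<alpha> - (2 - \<tau>)"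
    and V: "V = (\<lambda>k. merit_V f g h p \<alpha> \<beta> (\<xi> k) (y k) (x k))"
  shows "V k - V (Suc k) \<ge> ereal (- c / (2 * \<tau> * \<alpha>) * (norm (x (Suc k) - x k))\<^sup>2
      + (recip \<beta> / 2 - \<rho>\<^sub>p / 2) * (norm (y (Suc k) - y k))\<^sup>2)"
proof -
  define Q where "Q j w = f (x j) + h (x j) + (grad f (x j) + grad h (x j)) \<bullet> (w - x j)
      + 1 / (2 * \<alpha>) * (norm (w - x j))\<^sup>2" for j w
  define P where "P j w = p (y j) + \<xi> j \<bullet> (w - y j) + recip \<beta> / 2 * (norm (w - y j))\<^sup>2" for j w
  have Phi: "merit_Phi f g h p \<alpha> \<beta> (\<xi> j) w (y j) (x j) = ereal (Q j w + P j w) + g w" for j w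
    by (simp add: merit_Phi_def Q_def P_def add.assoc)
  note attained = merit_V_attained[OF f_smooth g_proper gen]
  have V_eq: "V j = ereal (Q j (y (Suc j)) + P j (y (Suc j))) + g (y (Suc j))" for j
    unfolding V attained(1) Phi ..
  obtain G where G: "g (y (Suc k)) = ereal G"
    using attained(2)[of k] by auto
  obtain G' where G': "g (y (Suc (Suc k))) = ereal G'"
    using attained(2)[of "Suc k"] by auto
  \<comment> \<open>The point \<open>y (Suc k)\<close>, where \<open>V k\<close> is attained, is a
    competitor in the infimum for \<open>V (Suc k)\<close>; both sides then contain the same finite
    value of \<open>g\<close>.\<close>
  have "V (Suc k) \<le> ereal (Q (Suc k) (y (Suc k)) + P (Suc k) (y (Suc k))) + g (y (Suc k))"
    unfolding V merit_V_def Phi[symmetric] by (rule INF_lower) simp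
  \<comment> \<open>The model of \<open>p\<close> in \<open>V (Suc k)\<close> is centred at
    \<open>y (Suc k)\<close>, so it is exact at this competitor.\<close>
  moreover have "P (Suc k) (y (Suc k)) = p (y (Suc k))"
    by (simp add: P_def)
  ultimately have le: "V (Suc k) \<le> ereal (Q (Suc k) (y (Suc k)) + p (y (Suc k)) + G)"
    by (simp add: G)

  have z: "z j = x j + \<alpha> *\<^sub>R grad f (x j)" for j
    using gen by (intro prox_smooth_eq[OF f_smooth]) (auto simp: generated_by_algorithm_def)
  \<comment> \<open>Eliminating \<open>z\<close> at both indices turns its update into the relation
    needed for the smooth terms.\<close>
  have "z (Suc k) = z k + \<tau> *\<^sub>R (y (Suc k) - x k)"
    using gen by (simp add: generated_by_algorithm_def)
  then have step: "\<tau> *\<^sub>R (y (Suc k) - x k)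
      = (x (Suc k) - x k) + \<alpha> *\<^sub>R (grad f (x (Suc k)) - grad f (x k))"
    unfolding z by (simp add: algebra_simps)
  have Q: "- c / (2 * \<tau> * \<alpha>) * (norm (x (Suc k) - x k))\<^sup>2 \<le> Q k (y (Suc k)) - Q (Suc k) (y (Suc k))"
    unfolding Q_def
    by (rule smooth_merit_descent[OF f_smooth h_smooth h_weak \<rho>\<^sub>h f_strong \<tau> \<mu> \<alpha>_eq step c])

  have "\<xi> k \<in> limiting_subdiff p (y k)"
    using gen by (simp add: generated_by_algorithm_def)
  \<comment> \<open>The linear model of \<open>p\<close> at \<open>y k\<close> overestimates
    \<open>p\<close> up to a loss of \<rho>/2 with \<rho> = \<open>\<rho>\<^sub>p\<close>, set
    against the gain \<open>recip \<beta> / 2\<close> from the quadratic term of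
    \<open>P\<close>.\<close>
  then have "p (y (Suc k)) \<le> p (y k) + \<xi> k \<bullet> (y (Suc k) - y k) + \<rho>\<^sub>p / 2 * (norm (y (Suc k) - y k))\<^sup>2"
    using p_weak by (intro limiting_subgradient_weakly_concave) (simp_all add: weakly_convex_def)
  then have P: "(recip \<beta> / 2 - \<rho>\<^sub>p / 2) * (norm (y (Suc k) - y k))\<^sup>2 \<le> P k (y (Suc k)) - p (y (Suc k))"
    by (simp add: P_def left_diff_distrib)
  show ?thesis
    using le Q P unfolding V_eq G G' by simp
qed

section \<open>The stepsize interval and monotonicity of the merit values\<close>

theorem theorem3p12:
  fixes f h p :: "real ^ 'n \<Rightarrow> real" and g :: "real ^ 'n \<Rightarrow> ereal"
    and L\<^sub>f L\<^sub>h \<rho>\<^sub>p \<rho>\<^sub>h \<sigma>\<^sub>f \<nu> \<theta>\<^sub>0 \<theta>\<^sub>1 \<theta>\<^sub>2 \<tau> :: real and r :: "real \<Rightarrow> real"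
  assumes f_smooth: "L_smooth L\<^sub>f f"
    and g_proper: "proper_fun g" and g_closed: "lower_semicont g"
    and h_smooth: "L_smooth L\<^sub>h h"
    and p_cont: "\<exists>U. open U \<and> edom g \<subseteq> U \<and> continuous_on U p"
    and p_weak: "weakly_convex \<rho>\<^sub>p (\<lambda>x. - p x)"
    and \<rho>\<^sub>h_range: "\<rho>\<^sub>h \<in> {0..L\<^sub>h}"
    and h_weak: "convex_on UNIV (\<lambda>x. h x + \<rho>\<^sub>h / 2 * (norm x)\<^sup>2)"
    and \<sigma>\<^sub>f_pos: "0 < \<sigma>\<^sub>f"
    and f_strong: "strongly_convex \<sigma>\<^sub>f f"
    and \<nu>_eq: "\<nu> = \<sigma>\<^sub>f / (L\<^sub>f + L\<^sub>h)"
    and \<theta>\<^sub>0_eq: "\<theta>\<^sub>0 = L\<^sub>h * (L\<^sub>f\<^sup>2 - \<sigma>\<^sub>f\<^sup>2) / (L\<^sub>f * (L\<^sub>f + L\<^sub>h)\<^sup>2)"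
    and \<theta>\<^sub>1_eq: "\<theta>\<^sub>1 = L\<^sub>h / (L\<^sub>f + L\<^sub>h)"
    and \<theta>\<^sub>2_eq: "\<theta>\<^sub>2 = \<rho>\<^sub>h / (L\<^sub>f + L\<^sub>h)"
    and \<tau>_ge: "2 \<le> \<tau>"
    and \<delta>_pos: "(\<tau> * \<nu> - \<tau> * \<theta>\<^sub>1 - 2 * (\<tau> - 1) * \<theta>\<^sub>2)\<^sup>2 - 8 * (\<theta>\<^sub>0 + \<nu>) * (\<tau> - 2) > 0"
    and lin_pos: "\<tau> * \<nu> - \<tau> * \<theta>\<^sub>1 - 2 * (\<tau> - 1) * \<theta>\<^sub>2 > 0"
    and r_eq: "\<And>\<mu>. r \<mu> = \<tau>\<^sup>2 * (\<theta>\<^sub>0 + \<nu>) * \<mu>\<^sup>2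
                  - \<tau>\<^sup>2 * (\<nu> - \<theta>\<^sub>1 - 2 * (\<tau> - 1) / \<tau> * \<theta>\<^sub>2) * \<mu> + 2 * (\<tau> - 2)"
  shows "\<exists>\<mu>\<^sub>1 \<mu>\<^sub>2. {\<mu>. r \<mu> = 0} = {\<mu>\<^sub>1, \<mu>\<^sub>2} \<and> 0 \<le> \<mu>\<^sub>1 \<and> \<mu>\<^sub>1 < \<mu>\<^sub>2 \<and> \<mu>\<^sub>2 \<le> 1 \<and>
    (\<forall>\<mu> \<alpha> \<beta> \<gamma> x y z \<xi> c V.
       0 < \<mu> \<longrightarrow> \<mu> \<in> {\<mu>\<^sub>1..\<mu>\<^sub>2} \<longrightarrow> \<alpha> = \<tau> * \<mu> / (2 * (L\<^sub>f + L\<^sub>h)) \<longrightarrow>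
       generated_by_algorithm f g h p \<tau> \<alpha> \<beta> \<gamma> x y z \<xi> \<longrightarrow>
       c = 2 * L\<^sub>h * L\<^sub>f * \<alpha>\<^sup>2
           + (\<tau> * \<mu> * \<sigma>\<^sub>f + \<tau> * L\<^sub>h + 2 * (\<tau> - 1) * \<rho>\<^sub>h - \<tau> * \<sigma>\<^sub>f
              - \<tau> * L\<^sub>h * \<sigma>\<^sub>f\<^sup>2 * \<mu> / (L\<^sub>f * (L\<^sub>f + L\<^sub>h))) * \<alpha> - (2 - \<tau>) \<longrightarrow>
       V = (\<lambda>k. merit_V f g h p \<alpha> \<beta> (\<xi> k) (y k) (x k)) \<longrightarrow>
       (\<forall>k. V k = merit_Phi f g h p \<alpha> \<beta> (\<xi> k) (y (Suc k)) (y k) (x k) \<and> \<bar>V k\<bar> \<noteq> \<infinity>) \<and>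
       (\<forall>k\<ge>1. V (k - 1) - V k \<ge>
          ereal (- c / (2 * \<tau> * \<alpha>) * (norm (x k - x (k - 1)))\<^sup>2
                 + (recip \<beta> / 2 - \<rho>\<^sub>p / 2) * (norm (y k - y (k - 1)))\<^sup>2)) \<and>
       (\<beta> \<le> 1 / ereal \<rho>\<^sub>p \<longrightarrow>
          decseq V \<and>
          (\<forall>k\<ge>1. (\<mu> \<in> {\<mu>\<^sub>1<..<\<mu>\<^sub>2} \<and> x k \<noteq> x (k - 1)) \<or>
                   (\<beta> < 1 / ereal \<rho>\<^sub>p \<and> y k \<noteq> y (k - 1)) \<longrightarrow> V k < V (k - 1))))"
proof -
  have L\<^sub>h: "0 \<le> L\<^sub>h" and \<rho>\<^sub>h: "0 \<le> \<rho>\<^sub>h"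
    using \<rho>\<^sub>h_range by auto
  have \<sigma>\<^sub>f_le: "\<sigma>\<^sub>f \<le> L\<^sub>f"
    by (rule strongly_convex_le_smooth[OF f_strong f_smooth])
  have L\<^sub>f: "0 < L\<^sub>f" and S: "0 < L\<^sub>f + L\<^sub>h"
    using \<sigma>\<^sub>f_le \<sigma>\<^sub>f_pos L\<^sub>h by auto
  have "\<sigma>\<^sub>f\<^sup>2 \<le> L\<^sub>f\<^sup>2"
    using \<sigma>\<^sub>f_le \<sigma>\<^sub>f_pos by (intro power_mono) auto
  then have \<theta>: "0 \<le> \<theta>\<^sub>0" "0 \<le> \<theta>\<^sub>1" "0 \<le> \<theta>\<^sub>2" and \<nu>: "0 < \<nu>"
    unfolding \<theta>\<^sub>0_eq \<theta>\<^sub>1_eq \<theta>\<^sub>2_eq \<nu>_eq using L\<^sub>h L\<^sub>f S \<rho>\<^sub>h \<sigma>\<^sub>f_pos by simp_all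
  \<comment> \<open>\<open>B\<close> has one factor \<tau> pulled out, so that its sign and the
    discriminant refer directly to the two assumed inequalities.\<close>
  define A B C where "A = \<tau>\<^sup>2 * (\<theta>\<^sub>0 + \<nu>)"
    and "B = \<tau> * (\<tau> * \<nu> - \<tau> * \<theta>\<^sub>1 - 2 * (\<tau> - 1) * \<theta>\<^sub>2)" and "C = 2 * (\<tau> - 2)"
  have r: "r \<mu> = A * \<mu>\<^sup>2 - B * \<mu> + C" for \<mu>
    unfolding r_eq A_def B_def C_def using \<tau>_ge by (simp add: field_simps power2_eq_square)
  have A: "0 < A" and B: "0 < B" and C: "0 \<le> C"
    unfolding A_def B_def C_def using \<theta> \<nu> \<tau>_ge lin_pos by simp_all
  have "B\<^sup>2 - 4 * A * C = \<tau>\<^sup>2 * ((\<tau> * \<nu> - \<tau> * \<theta>\<^sub>1 - 2 * (\<tau> - 1) * \<theta>\<^sub>2)\<^sup>2 - 8 * (\<theta>\<^sub>0 + \<nu>) * (\<tau> - 2))"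
    unfolding A_def B_def C_def power_mult_distrib by (simp add: algebra_simps)
  then have disc: "0 < B\<^sup>2 - 4 * A * C"
    using \<delta>_pos \<tau>_ge by simp
  \<comment> \<open>This is \<open>r 1\<close>: the contributions of \<open>\<nu>\<close> cancel and
    only nonnegative terms remain.\<close>
  have "A - B + C = \<tau>\<^sup>2 * \<theta>\<^sub>0 + \<tau>\<^sup>2 * \<theta>\<^sub>1 + \<tau> * (2 * (\<tau> - 1) * \<theta>\<^sub>2) + C"
    by (simp add: A_def B_def algebra_simps power2_eq_square)
  then have one: "0 \<le> A - B + C"
    using \<theta> \<tau>_ge C by simp
  \<comment> \<open>This places the vertex \<open>B / (2 * A)\<close> of \<open>r\<close> at or
    below 1.\<close>
  have "2 * A - B = 2 * (\<tau>\<^sup>2 * \<theta>\<^sub>0) + \<tau>\<^sup>2 * \<nu> + \<tau>\<^sup>2 * \<theta>\<^sub>1 + \<tau> * (2 * (\<tau> - 1) * \<theta>\<^sub>2)"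
    by (simp add: A_def B_def algebra_simps power2_eq_square)
  moreover have "0 \<le> \<dots>"
    using \<theta> \<nu> \<tau>_ge by (intro add_nonneg_nonneg) simp_all
  ultimately have vertex: "B \<le> 2 * A"
    by linarith
  obtain u v where uv: "0 \<le> u" "u < v" "v \<le> 1"
    and factored: "\<And>\<mu>. A * \<mu>\<^sup>2 - B * \<mu> + C = A * (\<mu> - u) * (\<mu> - v)"
    using quadratic_roots_in_unit_interval[OF A B C disc one vertex] by blast
  have r_factored: "r \<mu> = A * (\<mu> - u) * (\<mu> - v)" for \<mu>
    by (simp add: r factored)
  have r_nonpos: "r \<mu> \<le> 0" if "\<mu> \<in> {u..v}" for \<mu>
    unfolding r_factored using that A by (simp add: mult_nonneg_nonpos)
  have r_neg: "r \<mu> < 0" if "\<mu> \<in> {u<..<v}" for \<mu>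
    unfolding r_factored using that A by (simp add: mult_pos_neg)
  have roots: "{\<mu>. r \<mu> = 0} = {u, v}"
    using A by (auto simp: r_factored)
  have c_eq: "2 * L\<^sub>h * L\<^sub>f * \<alpha>\<^sup>2
           + (\<tau> * \<mu> * \<sigma>\<^sub>f + \<tau> * L\<^sub>h + 2 * (\<tau> - 1) * \<rho>\<^sub>h - \<tau> * \<sigma>\<^sub>f
              - \<tau> * L\<^sub>h * \<sigma>\<^sub>f\<^sup>2 * \<mu> / (L\<^sub>f * (L\<^sub>f + L\<^sub>h))) * \<alpha> - (2 - \<tau>) = r \<mu> / 2"
    if "\<alpha> = \<tau> * \<mu> / (2 * (L\<^sub>f + L\<^sub>h))" for \<mu> \<alpha>
  proof -
    \<comment> \<open>With this reciprocal as an atom, \<open>\<alpha>\<close>, \<open>\<nu>\<close>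
      and the \<open>\<theta>\<close> constants are polynomial in \<open>i\<close>, and only
      division by \<open>L\<^sub>f\<close> remains in the identity.\<close>
    define i where "i = 1 / (L\<^sub>f + L\<^sub>h)"
    have \<alpha>: "\<alpha> = \<tau> * \<mu> * i / 2" and \<sigma>: "\<tau> * L\<^sub>h * \<sigma>\<^sub>f\<^sup>2 * \<mu> / (L\<^sub>f * (L\<^sub>f + L\<^sub>h)) = \<tau> * L\<^sub>h * \<sigma>\<^sub>f\<^sup>2 * \<mu> * i / L\<^sub>f"
      using that by (simp_all add: i_def)
    have \<nu>': "\<nu> = \<sigma>\<^sub>f * i" and \<theta>': "\<theta>\<^sub>1 = L\<^sub>h * i" "\<theta>\<^sub>2 = \<rho>\<^sub>h * i"
      by (simp_all add: \<nu>_eq \<theta>\<^sub>1_eq \<theta>\<^sub>2_eq i_def)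
    have "\<theta>\<^sub>0 = L\<^sub>h * (L\<^sub>f\<^sup>2 - \<sigma>\<^sub>f\<^sup>2) / L\<^sub>f * i\<^sup>2"
      by (simp add: \<theta>\<^sub>0_eq i_def power_divide)
    also have "L\<^sub>h * (L\<^sub>f\<^sup>2 - \<sigma>\<^sub>f\<^sup>2) / L\<^sub>f = L\<^sub>h * L\<^sub>f - L\<^sub>h * \<sigma>\<^sub>f\<^sup>2 / L\<^sub>f"
      using L\<^sub>f by (simp add: field_simps power2_eq_square)
    finally have \<theta>\<^sub>0': "\<theta>\<^sub>0 = (L\<^sub>h * L\<^sub>f - L\<^sub>h * \<sigma>\<^sub>f\<^sup>2 / L\<^sub>f) * i\<^sup>2" .
    show ?thesis
      unfolding r A_def B_def C_def \<sigma> \<alpha> \<nu>' \<theta>' \<theta>\<^sub>0'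
      by (simp add: algebra_simps power2_eq_square add_divide_distrib diff_divide_distrib)
  qed
  show ?thesis
  proof (rule exI[of _ u], rule exI[of _ v], intro conjI[OF roots] conjI[OF uv(1)] conjI[OF uv(2)]
      conjI[OF uv(3)] allI impI)
    fix \<mu> \<alpha> :: real and \<beta> :: ereal and \<gamma> :: real and x y z \<xi> :: "nat \<Rightarrow> real ^ 'n"
      and c :: real and V :: "nat \<Rightarrow> ereal"
    assume \<mu>: "0 < \<mu>" "\<mu> \<in> {u..v}" and \<alpha>_eq: "\<alpha> = \<tau> * \<mu> / (2 * (L\<^sub>f + L\<^sub>h))"
      and gen: "generated_by_algorithm f g h p \<tau> \<alpha> \<beta> \<gamma> x y z \<xi>"
      and c: "c = 2 * L\<^sub>h * L\<^sub>f * \<alpha>\<^sup>2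
           + (\<tau> * \<mu> * \<sigma>\<^sub>f + \<tau> * L\<^sub>h + 2 * (\<tau> - 1) * \<rho>\<^sub>h - \<tau> * \<sigma>\<^sub>f
              - \<tau> * L\<^sub>h * \<sigma>\<^sub>f\<^sup>2 * \<mu> / (L\<^sub>f * (L\<^sub>f + L\<^sub>h))) * \<alpha> - (2 - \<tau>)"
      and V: "V = (\<lambda>k. merit_V f g h p \<alpha> \<beta> (\<xi> k) (y k) (x k))"
    note attained = merit_V_attained[OF f_smooth g_proper gen]
    have pos: "0 < \<alpha>" "0 < \<beta>"
      using gen by (auto simp: generated_by_algorithm_def)
    have \<rho>\<^sub>p: "0 \<le> \<rho>\<^sub>p"
      using p_weak by (simp add: weakly_convex_def)
    have c_r: "c = r \<mu> / 2"
      unfolding c by (rule c_eq[OF \<alpha>_eq])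
    have V_eq: "V k = merit_Phi f g h p \<alpha> \<beta> (\<xi> k) (y (Suc k)) (y k) (x k)" for k
      unfolding V by (rule attained(1))
    have V_finite: "\<bar>V k\<bar> \<noteq> \<infinity>" for k
      using attained(2)[of k] unfolding V_eq merit_Phi_def by (cases "g (y (Suc k))") auto
    define t where "t k = - c / (2 * \<tau> * \<alpha>) * (norm (x (Suc k) - x k))\<^sup>2
        + (recip \<beta> / 2 - \<rho>\<^sub>p / 2) * (norm (y (Suc k) - y k))\<^sup>2" for k
    have descent: "V k - V (Suc k) \<ge> ereal (t k)" for k
      unfolding t_def using \<tau>_ge \<mu> uv(3)
      by (intro merit_V_descent[OF f_smooth g_proper h_smooth p_weak h_weak \<rho>\<^sub>h_range f_strong
            _ _ _ \<alpha>_eq gen c V]) auto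
    \<comment> \<open>All merit values are finite, so the bound can be put in additive form, free of
      extended-real subtraction.\<close>
    have descent': "V (Suc k) + ereal (t k) \<le> V k" for k
      using descent[of k] V_finite[of k] V_finite[of "Suc k"]
      by (cases "V k"; cases "V (Suc k)") auto
    have x_coeff: "0 \<le> - c / (2 * \<tau> * \<alpha>)"
      using r_nonpos[OF \<mu>(2)] \<tau>_ge pos by (simp add: c_r divide_nonpos_pos)
    have mono: "V (Suc k) \<le> V k" if "\<beta> \<le> 1 / ereal \<rho>\<^sub>p" for k
    proof -
      have "0 \<le> t k"
        using x_coeff recip_ge[OF pos(2) \<rho>\<^sub>p that] unfolding t_def
        by (intro add_nonneg_nonneg mult_nonneg_nonneg) auto
      then show ?thesis
        using descent'[of k] V_finite[of k] V_finite[of "Suc k"]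
        by (cases "V k"; cases "V (Suc k)") auto
    qed
    \<comment> \<open>The lower bound \<open>t k\<close> is positive only if an increment with
      positive coefficient is nonzero, hence the requirement that \<open>x\<close> or
      \<open>y\<close> moves. The non-strict bound on \<beta> keeps the \<open>y\<close> term
      nonnegative in the first case.\<close>
    have strict: "V (Suc k) < V k"
      if \<beta>: "\<beta> \<le> 1 / ereal \<rho>\<^sub>p"
        and "(\<mu> \<in> {u<..<v} \<and> x (Suc k) \<noteq> x k) \<or> (\<beta> < 1 / ereal \<rho>\<^sub>p \<and> y (Suc k) \<noteq> y k)" for k
    proof -
      have "0 < t k"
        using that(2)
      proof
        assume *: "\<mu> \<in> {u<..<v} \<and> x (Suc k) \<noteq> x k"
        then have "0 < - c / (2 * \<tau> * \<alpha>)"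
          using r_neg[of \<mu>] \<tau>_ge pos by (simp add: c_r divide_neg_pos)
        then show ?thesis
          using * recip_ge[OF pos(2) \<rho>\<^sub>p \<beta>] unfolding t_def
          by (intro add_pos_nonneg mult_pos_pos mult_nonneg_nonneg) auto
      next
        assume "\<beta> < 1 / ereal \<rho>\<^sub>p \<and> y (Suc k) \<noteq> y k"
        then show ?thesis
          using x_coeff recip_gt[OF pos(2) \<rho>\<^sub>p] unfolding t_def
          by (intro add_nonneg_pos mult_pos_pos mult_nonneg_nonneg) auto
      qed
      then show ?thesis
        using descent'[of k] V_finite[of k] V_finite[of "Suc k"]
        by (cases "V k"; cases "V (Suc k)") auto
    qed
    show "(\<forall>k. V k = merit_Phi f g h p \<alpha> \<beta> (\<xi> k) (y (Suc k)) (y k) (x k) \<and> \<bar>V k\<bar> \<noteq> \<infinity>) \<and>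
       (\<forall>k\<ge>1. V (k - 1) - V k \<ge>
          ereal (- c / (2 * \<tau> * \<alpha>) * (norm (x k - x (k - 1)))\<^sup>2
                 + (recip \<beta> / 2 - \<rho>\<^sub>p / 2) * (norm (y k - y (k - 1)))\<^sup>2)) \<and>
       (\<beta> \<le> 1 / ereal \<rho>\<^sub>p \<longrightarrow>
          decseq V \<and>
          (\<forall>k\<ge>1. (\<mu> \<in> {u<..<v} \<and> x k \<noteq> x (k - 1)) \<or>
                   (\<beta> < 1 / ereal \<rho>\<^sub>p \<and> y k \<noteq> y (k - 1)) \<longrightarrow> V k < V (k - 1)))"
    proof (intro conjI allI impI)
      show "V k = merit_Phi f g h p \<alpha> \<beta> (\<xi> k) (y (Suc k)) (y k) (x k)" for k
        by (rule V_eq)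
      show "\<bar>V k\<bar> \<noteq> \<infinity>" for k
        by (rule V_finite)
      \<comment> \<open>Natural subtraction truncates at 0; \<open>1 \<le> k\<close> ensures
        \<open>Suc (k - 1) = k\<close>.\<close>
      show "V (k - 1) - V k \<ge> ereal (- c / (2 * \<tau> * \<alpha>) * (norm (x k - x (k - 1)))\<^sup>2
          + (recip \<beta> / 2 - \<rho>\<^sub>p / 2) * (norm (y k - y (k - 1)))\<^sup>2)" if "1 \<le> k" for k
        using descent[of "k - 1"] that by (simp add: t_def)
      show "decseq V" if "\<beta> \<le> 1 / ereal \<rho>\<^sub>p"
        using mono[OF that] by (rule decseq_SucI)
      show "V k < V (k - 1)" if "\<beta> \<le> 1 / ereal \<rho>\<^sub>p" "1 \<le> k"
        "(\<mu> \<in> {u<..<v} \<and> x k \<noteq> x (k - 1)) \<or> (\<beta> < 1 / ereal \<rho>\<^sub>p \<and> y k \<noteq> y (k - 1))" for k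
        using strict[OF that(1), of "k - 1"] that(2,3) by simp
    qed
  qed
qed

end
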